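(* Fix an integer $b\ge2$ and $\lambda\in(1/b,1)$, and let $\phi:\mathbb{R}\to\mathbb{R}$ be $\mathbb{Z}$-periodic and of class $C^5$. Then exactly one of the following holds: (i) $W=W^\phi_{\lambda,b}$ is $C^5$ and $\phi$ satisfies condition (H$^*$); (ii) $W$ is not Lipschitz and $\phi$ satisfies condition (H).
   Context: $W^\phi_{\lambda,b}(x)=\sum_{n\ge0}\lambda^n\phi(b^nx)$. Let $\Lambda=\{0,1,\dots,b-1\}$, $\Sigma=\Lambda^{\mathbb{Z}_+}$, $\gamma=1/(b\lambda)\in(1/b,1)$. For a $\mathbb{Z}$-periodic $C^1$ function $\phi$ and $\mathbf{j}=j_1j_2\cdots\in\Sigma$, define $Y(x,\mathbf{j})=-\sum_{n=1}^\infty\gamma^n\phi'\!\left(\frac{x}{b^n}+\frac{j_1}{b^n}+\frac{j_2}{b^{n-1}}+\cdots+\frac{j_n}{b}\right)$, $x\in\mathbb{R}$. Condition (H): for all $\mathbf{i}\ne\mathbf{j}$ in $\Sigma$, the function $x\mapsto Y(x,\mathbf{j})-Y(x,\mathbf{i})$ is not identically zero. Condition (H$^*$): $Y(x,\mathbf{j})-Y(x,\mathbf{i})\equiv0$ for all $\mathbf{i},\mathbf{j}\in\Sigma$. *)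

theory Defs
  imports "HOL-Analysis.Analysis"
begin

definition Ck :: "nat \<Rightarrow> (real \<Rightarrow> real) \<Rightarrow> bool" where
  "Ck k f \<longleftrightarrow> (\<forall>j<k. \<forall>x. ((deriv ^^ j) f) differentiable (at x))
                 \<and> continuous_on UNIV ((deriv ^^ k) f)"

definition periodic1 :: "(real \<Rightarrow> real) \<Rightarrow> bool" where
  "periodic1 f \<longleftrightarrow> (\<forall>x. f (x + 1) = f x)"

definition W :: "real \<Rightarrow> nat \<Rightarrow> (real \<Rightarrow> real) \<Rightarrow> real \<Rightarrow> real" where
  "W lam b phi x = (\<Sum>n. lam ^ n * phi (real b ^ n * x))"

text \<open>Symbolic space Sigma = Lambda^{Z_+}; a word j_1 j_2 ... is encoded as a function
  j :: nat => nat with j_k = j (k - 1).\<close>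
definition Sigma_b :: "nat \<Rightarrow> (nat \<Rightarrow> nat) set" where
  "Sigma_b b = {j. \<forall>n. j n < b}"

definition Y :: "real \<Rightarrow> nat \<Rightarrow> (real \<Rightarrow> real) \<Rightarrow> real \<Rightarrow> (nat \<Rightarrow> nat) \<Rightarrow> real" where
  "Y lam b phi x j =
     - (\<Sum>m. let n = Suc m in
          (1 / (real b * lam)) ^ n *
          deriv phi (x / real b ^ n + (\<Sum>k=1..n. real (j (k - 1)) / real b ^ (n + 1 - k))))"

definition cond_H :: "real \<Rightarrow> nat \<Rightarrow> (real \<Rightarrow> real) \<Rightarrow> bool" where
  "cond_H lam b phi \<longleftrightarrow>
     (\<forall>i\<in>Sigma_b b. \<forall>j\<in>Sigma_b b. i \<noteq> j \<longrightarrow>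
        \<not> (\<forall>x. Y lam b phi x j - Y lam b phi x i = 0))"

definition cond_H_star :: "real \<Rightarrow> nat \<Rightarrow> (real \<Rightarrow> real) \<Rightarrow> bool" where
  "cond_H_star lam b phi \<longleftrightarrow>
     (\<forall>i\<in>Sigma_b b. \<forall>j\<in>Sigma_b b. \<forall>x. Y lam b phi x j - Y lam b phi x i = 0)"

end

theory Submission
  imports Defs
begin

text \<open>
  If \<open>W\<close> is Lipschitz, comparing the functional equation along two inverse branches of
  \<open>x \<mapsto> b\<^sup>n x\<close> and differentiating shows that \<open>Y(x, j)\<close> does not depend on \<open>j\<close>; along the branch
  with all digits zero it gives \<open>W(x) = W(0) - \<Sum> \<lambda>\<^sup>-\<^sup>m (\<phi>(x / b\<^sup>m) - \<phi>(0))\<close>, summed over \<open>m \<ge> 1\<close>,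
  whose derivatives converge uniformly up to order 5.

  Conversely, let \<open>Y(x, i) = Y(x, j)\<close> for all \<open>x\<close>, with \<open>i \<noteq> j\<close>. View digit sequences as \<open>b\<close>-adic
  integers. Then \<open>\<delta> = j - i\<close> is a period of \<open>Y\<close> in its second argument, and so is every multiple
  \<open>k \<delta>\<close>. Hence the functions \<open>W(y + t) - W(y)\<close> of \<open>y\<close>, with \<open>t = k \<delta>\<^sub>n / b\<^sup>n\<close>, are Lipschitz with a
  constant independent of \<open>k\<close> and \<open>n\<close>. These \<open>t\<close> are dense modulo 1 because the \<open>b\<close>-adic integers
  have no torsion, so the bound holds for all real \<open>t\<close>, and boundedness of \<open>W\<close> makes \<open>W\<close> itself
  Lipschitz.
\<close>

section \<open>Periodic functions and elementary Lipschitz estimates\<close>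

lemma deriv_periodic:
  fixes g :: "real \<Rightarrow> real"
  assumes "\<And>x. g (x + 1) = g x"
  shows "deriv g (x + 1) = deriv g x"
proof -
  \<comment> \<open>\<open>deriv\<close> is a function of the set of candidate derivatives, so it
    suffices that these sets agree at \<open>x + 1\<close> and \<open>x\<close>.\<close>
  have "(g has_field_derivative D) (at (x + 1)) \<longleftrightarrow> (g has_field_derivative D) (at x)" for D
    using DERIV_shift[of g D x 1] assms by (simp add: add.commute)
  then show ?thesis by (simp add: deriv_def)
qed

lemma periodic_add_int:
  fixes g :: "real \<Rightarrow> 'a"
  assumes "\<And>x. g (x + 1) = g x"
  shows "g (x + of_int k) = g x"
proof -
  have nat: "g (y + of_nat n) = g y" for y n
  proof (induction n)
    case (Suc n)
    have "g (y + of_nat (Suc n)) = g (y + of_nat n + 1)" by (simp add: add_ac)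
    then show ?case using Suc assms by simp
  qed simp
  show ?thesis
  proof (cases "k \<ge> 0")
    case True
    then show ?thesis using nat[of x "nat k"] by simp
  next
    case False
    then show ?thesis using nat[of "x + of_int k" "nat (- k)"] by simp
  qed
qed

lemma periodic_continuous_bounded:
  fixes g :: "real \<Rightarrow> real"
  assumes per: "\<And>x. g (x + 1) = g x" and cont: "continuous_on UNIV g"
  obtains B where "B \<ge> 0" "\<And>x. \<bar>g x\<bar> \<le> B"
proof -
  have "compact (g ` {0..1})"
    using cont by (intro compact_continuous_image) (auto intro: continuous_on_subset)
  then obtain B where B: "\<And>x. x \<in> {0..1} \<Longrightarrow> \<bar>g x\<bar> \<le> B"
    by (metis bounded_iff compact_imp_bounded image_eqI real_norm_def)
  have "\<bar>g x\<bar> \<le> B" for x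
  proof -
    have "g (frac x) = g x"
      using periodic_add_int[of g "frac x" "\<lfloor>x\<rfloor>"] per by (simp add: frac_def)
    moreover have "frac x \<in> {0..1}"
      using frac_ge_0[of x] frac_lt_1[of x] by simp
    ultimately show ?thesis using B by metis
  qed
  then show thesis using that[of B] by (meson abs_ge_zero order_trans)
qed

lemma DERIV_abs_le_of_lipschitz:
  fixes g :: "real \<Rightarrow> real"
  assumes "(g has_field_derivative d) (at x)" "\<And>y. \<bar>g y - g x\<bar> \<le> C * \<bar>y - x\<bar>"
  shows "\<bar>d\<bar> \<le> C"
proof -
  have "((\<lambda>y. \<bar>(g y - g x) / (y - x)\<bar>) \<longlongrightarrow> \<bar>d\<bar>) (at x)"
    using assms(1) by (intro tendsto_rabs) (simp add: has_field_derivative_iff)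
  moreover have "eventually (\<lambda>y. \<bar>(g y - g x) / (y - x)\<bar> \<le> C) (at x)"
    using assms(2) by (auto simp: eventually_at_filter abs_divide divide_le_eq)
  ultimately show ?thesis
    by (intro tendsto_upperbound[of "\<lambda>y. \<bar>(g y - g x) / (y - x)\<bar>" _ "at x"]) auto
qed

lemma eq_0_if_geometric_bound:
  fixes a :: real
  assumes "0 \<le> r" "r < 1" "\<And>n. \<bar>a\<bar> \<le> c * r ^ n"
  shows "a = 0"
proof -
  have "(\<lambda>n. c * r ^ n) \<longlonglongrightarrow> c * 0"
    using assms by (intro tendsto_intros LIMSEQ_power_zero) auto
  then have "\<bar>a\<bar> \<le> c * 0"
    using assms(3) by (intro tendsto_lowerbound[of _ _ sequentially]) auto
  then show ?thesis by simp
qed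

lemma lipschitz_if_differences_lipschitz:
  fixes w :: "real \<Rightarrow> real"
  assumes bd: "\<And>x. \<bar>w x\<bar> \<le> M"
    and lip: "\<And>t x y. \<bar>(w (x + t) - w x) - (w (y + t) - w y)\<bar> \<le> C * \<bar>x - y\<bar>"
  shows "\<bar>w x - w y\<bar> \<le> C * \<bar>x - y\<bar>"
proof -
  \<comment> \<open>Increments over consecutive steps \<open>h\<close> differ from the first one by at most \<open>C * \<bar>h\<bar>\<close>, so an
    increment larger than that would make \<open>w\<close> grow linearly.\<close>
  have upper: "w (z + h) - w z \<le> C * \<bar>h\<bar>" for z h
  proof (rule ccontr)
    define d where "d = w (z + h) - w z - C * \<bar>h\<bar>"
    assume "\<not> w (z + h) - w z \<le> C * \<bar>h\<bar>"
    then have "d > 0" by (simp add: d_def)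
    \<comment> \<open>Take the points \<open>z + h\<close> and \<open>z\<close> and the translation
      \<open>m * h\<close> in \<open>lip\<close>: the four values regroup into two increments over
      \<open>h\<close>.\<close>
    have step: "w (z + real (Suc m) * h) - w (z + real m * h) \<ge> d" for m
      using lip[of "z + h" "real m * h" z] unfolding d_def by (simp add: algebra_simps)
    have "w (z + real N * h) - w z \<ge> real N * d" for N
    proof (induction N)
      case (Suc N)
      then show ?case using step[of N] by (simp add: algebra_simps)
    qed simp
    then have "real N * d \<le> 2 * M" for N
      using bd[of "z + real N * h"] bd[of z] by (smt (verit))
    moreover obtain N :: nat where "real N * d > 2 * M"
      using reals_Archimedean3[OF \<open>d > 0\<close>] by blast
    ultimately show False by (meson not_less)
  qed
  from upper[of y "x - y"] upper[of x "y - x"] show ?thesis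
    by (simp add: abs_le_iff abs_minus_commute)
qed

section \<open>Coherent sequences of integers\<close>

text \<open>Coherent sequences represent elements of the inverse limit of the rings of integers
  modulo \<open>b\<^sup>n\<close>; the digit expansion embeds the symbolic space there, where it can be added and
  multiplied by integers.\<close>

definition coherent :: "nat \<Rightarrow> (nat \<Rightarrow> int) \<Rightarrow> bool" where
  "coherent b u \<longleftrightarrow> (\<forall>n. int b ^ n dvd u (Suc n) - u n)"

lemma coherent_add: "coherent b u \<Longrightarrow> coherent b v \<Longrightarrow> coherent b (\<lambda>n. u n + v n)"
  unfolding coherent_def by (simp add: add_diff_add)

lemma coherent_diff: "coherent b u \<Longrightarrow> coherent b v \<Longrightarrow> coherent b (\<lambda>n. u n - v n)"
  unfolding coherent_def
proof
  fix n
  assume "\<forall>n. int b ^ n dvd u (Suc n) - u n" "\<forall>n. int b ^ n dvd v (Suc n) - v n"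
  then have "int b ^ n dvd (u (Suc n) - u n) - (v (Suc n) - v n)" by (blast intro: dvd_diff)
  then show "int b ^ n dvd u (Suc n) - v (Suc n) - (u n - v n)" by (simp add: algebra_simps)
qed

lemma coherent_mult: "coherent b u \<Longrightarrow> coherent b (\<lambda>n. k * u n)"
  unfolding coherent_def by (simp flip: right_diff_distrib)

lemma coherent_const: "coherent b (\<lambda>n. k)"
  by (simp add: coherent_def)

lemma coherent_dvd:
  assumes "coherent b u" "m \<le> n"
  shows "int b ^ m dvd u n - u m"
  using assms(2)
proof (induction rule: dec_induct)
  case (step n)
  have "int b ^ m dvd u (Suc n) - u n"
    using assms(1) step by (meson coherent_def dvd_trans le_imp_power_dvd)
  then show ?case using step dvd_add[of "int b ^ m" "u (Suc n) - u n" "u n - u m"] by simp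
qed simp

text \<open>The \<open>b\<close>-adic integer whose digits are the letters of the word, truncated at
  level \<open>n\<close>. The first letter is the units digit, matching its division by the highest
  power of \<open>b\<close> in \<open>Y\<close>.\<close>

definition digits :: "nat \<Rightarrow> (nat \<Rightarrow> nat) \<Rightarrow> nat \<Rightarrow> int" where
  "digits b j n = (\<Sum>k<n. int (j k) * int b ^ k)"

lemma coherent_digits: "coherent b (digits b j)"
  by (simp add: coherent_def digits_def)

text \<open>At the first position \<open>k\<close> where the words differ, the difference at level
  \<open>Suc k\<close> is \<open>b ^ k\<close> times a nonzero integer of absolute value below
  \<open>b\<close>.\<close>

lemma digits_neq:
  assumes "b \<ge> 2" "i \<in> Sigma_b b" "j \<in> Sigma_b b" "i \<noteq> j"
  shows "\<exists>n. \<not> int b ^ n dvd digits b i n - digits b j n"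
proof -
  define k where "k = (LEAST k. i k \<noteq> j k)"
  have k: "i k \<noteq> j k" "\<And>l. l < k \<Longrightarrow> i l = j l"
    using assms(4) LeastI_ex[of "\<lambda>k. i k \<noteq> j k"] unfolding k_def
    by (auto simp: fun_eq_iff dest: not_less_Least)
  have "digits b i k = digits b j k"
    using k(2) by (simp add: digits_def)
  then have eq: "digits b i (Suc k) - digits b j (Suc k) = int b ^ k * (int (i k) - int (j k))"
    by (simp add: digits_def algebra_simps)
  have "\<not> int b dvd int (i k) - int (j k)"
  proof
    assume "int b dvd int (i k) - int (j k)"
    then have "int b \<le> \<bar>int (i k) - int (j k)\<bar>"
      using k(1) by (intro zdvd_imp_le) (auto simp: dvd_abs_iff)
    moreover have "i k < b" "j k < b" using assms(2,3) by (auto simp: Sigma_b_def)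
    ultimately show False by linarith
  qed
  then have "\<not> int b ^ Suc k dvd digits b i (Suc k) - digits b j (Suc k)"
    using assms(1) unfolding eq by (simp add: mult.commute[of "int b"])
  then show ?thesis by blast
qed

text \<open>Strong induction divides the common factor of \<open>K\<close> and \<open>b\<close> out
  of \<open>K\<close>; a \<open>K\<close> coprime to \<open>b\<close> cancels directly. This covers
  composite \<open>b\<close>, where the \<open>b\<close>-adic integers may have zero
  divisors.\<close>

lemma coherent_torsion_free:
  assumes "b \<ge> 2" and "(K::nat) > 0" "coherent b u" "\<And>n. int b ^ n dvd int K * u n"
  shows "int b ^ n dvd u n"
  using assms(2-4)
proof (induction K arbitrary: u n rule: less_induct)
  case (less K)
  show ?case
  proof (cases "coprime K b")
    case True
    then have "coprime (int b ^ n) (int K)"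
      by (simp add: coprime_commute)
    then show ?thesis using less.prems(3)[of n] coprime_dvd_mult_right_iff by blast
  next
    case False
    define g where "g = gcd K b"
    obtain K' b' where K': "K = g * K'" and b': "b = g * b'"
      unfolding g_def by (meson dvdE gcd_dvd1 gcd_dvd2)
    have "g \<noteq> 1" "g > 0" using False less.prems(1) by (auto simp: g_def coprime_iff_gcd_eq_1)
    then have "K' < K" "K' > 0" using K' less.prems(1) by auto
    have dv: "int b ^ n dvd int K' * u n" for n
    proof -
      \<comment> \<open>Multiplying by \<open>b'\<close> turns \<open>K\<close> into
        \<open>b * K'\<close>. Cancelling \<open>b\<close> costs one power, so the argument starts
        at level \<open>Suc n\<close> and coherence brings it back to \<open>n\<close>.\<close>
      have "int b ^ Suc n dvd int b' * (int K * u (Suc n))"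
        using less.prems(3) by (meson dvd_mult)
      also have "int b' * (int K * u (Suc n)) = int b * (int K' * u (Suc n))"
        by (simp add: K' b')
      finally have "int b ^ n dvd int K' * u (Suc n)" using assms(1) by simp
      moreover have "int b ^ n dvd int K' * (u (Suc n) - u n)"
        using less.prems(2) by (simp add: coherent_def)
      ultimately have "int b ^ n dvd int K' * u (Suc n) - int K' * (u (Suc n) - u n)"
        by (rule dvd_diff)
      then show ?thesis by (simp add: algebra_simps)
    qed
    show ?thesis using less.IH[OF \<open>K' < K\<close> \<open>K' > 0\<close> less.prems(2) dv] .
  qed
qed

text \<open>Modulo 1, the multiples of \<open>u n / b ^ n\<close> form the group generated by
  \<open>1 / M\<close>, with \<open>M\<close> the order of \<open>u n\<close> modulo
  \<open>b ^ n\<close>. Absence of torsion makes these orders unbounded.\<close>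

lemma coherent_multiples_dense:
  fixes t e :: real
  assumes "b \<ge> 2" "coherent b u" "\<not> int b ^ N dvd u N" "e > 0"
  shows "\<exists>n k l. \<bar>real_of_int (k * u n) / real b ^ n + real_of_int l - t\<bar> < e"
proof -
  obtain R :: nat where R: "1 / e < real R" using reals_Archimedean2 by blast
  have Rpos: "real R > 0" using R assms(4) less_trans[of 0 "1 / e" "real R"] by simp
  \<comment> \<open>\<open>fact R\<close> is a multiple of every order up to \<open>R\<close>, so at
    such a level the order exceeds \<open>R\<close>.\<close>
  have "\<exists>n. \<not> int b ^ n dvd int (fact R) * u n"
    using coherent_torsion_free[OF assms(1) _ assms(2), of "fact R" N] assms(3) by auto
  then obtain n where n: "\<not> int b ^ n dvd int (fact R) * u n" by blast
  define g where "g = gcd (u n) (int b ^ n)"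
  have bpos: "int b ^ n > 0" using assms(1) by simp
  then have gpos: "g > 0" by (simp add: g_def)
  have "g dvd int b ^ n" "g dvd u n" by (simp_all add: g_def)
  then obtain M v where M: "int b ^ n = g * M" and v: "u n = g * v" by (auto elim!: dvdE)
  have "g * M > 0" using bpos unfolding M .
  then have Mpos: "M > 0" using gpos by (simp only: zero_less_mult_pos)
  have MR: "M > int R"
  proof (rule ccontr)
    assume "\<not> M > int R"
    then have "nat M dvd fact R" using Mpos by (intro dvd_fact) auto
    then have "M dvd int (fact R)" using Mpos by (simp flip: int_dvd_int_iff)
    then have "g * M dvd int (fact R) * (g * v)" by (simp add: mult_dvd_mono mult.left_commute)
    then show False using n M v by simp
  qed
  \<comment> \<open>Bezout's identity divided by \<open>b ^ n\<close> produces the generator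
    \<open>1 / M\<close>; its multiple \<open>q / M\<close> lies within \<open>1 / M\<close> of
    \<open>t\<close>.\<close>
  obtain k l where kl: "k * u n + l * int b ^ n = g"
    unfolding g_def using bezout_int by metis
  define q where "q = \<lfloor>t * M\<rfloor>"
  have rb: "real b ^ n = real_of_int g * real_of_int M" using arg_cong[OF M, of real_of_int] by simp
  have "real_of_int (k * u n) + real_of_int l * real b ^ n = real_of_int g"
    using arg_cong[OF kl, of real_of_int] by simp
  then have "real_of_int (k * u n) / real b ^ n + real_of_int l = 1 / M"
    using gpos Mpos unfolding rb by (simp add: field_simps)
  then have "q * (real_of_int (k * u n) / real b ^ n + real_of_int l) = q * (1 / M)"
    by (rule arg_cong)
  then have eq: "real_of_int ((q * k) * u n) / real b ^ n + real_of_int (q * l) = q / M"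
    by (simp only: of_int_mult distrib_left times_divide_eq_right mult_1_right mult.assoc)
  have "q / M - t = (q - t * M) / M" using Mpos by (simp add: diff_divide_distrib)
  then have "\<bar>q / M - t\<bar> = \<bar>q - t * M\<bar> / M" using Mpos by simp
  also have "\<dots> \<le> 1 / M" using Mpos unfolding q_def by (intro divide_right_mono) linarith+
  also have "\<dots> < 1 / real R" using MR Rpos by (intro divide_strict_left_mono) auto
  also have "\<dots> < e" using R Rpos assms(4) by (simp add: divide_less_eq mult.commute)
  finally have "\<bar>real_of_int ((q * k) * u n) / real b ^ n + real_of_int (q * l) - t\<bar> < e"
    unfolding eq .
  then show ?thesis by blast
qed

section \<open>The dichotomy\<close>

locale weierstrass =
  fixes b :: nat and lam :: real and phi :: "real \<Rightarrow> real"
  assumes b_ge: "b \<ge> 2" and lam_gt: "1 / real b < lam" and lam_less_1: "lam < 1"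
    and phi_per: "phi (x + 1) = phi x" and phi_C5: "Ck 5 phi"
begin

section \<open>Basic properties of \<open>phi\<close> and \<open>W\<close>\<close>

definition gam :: real where "gam = 1 / (real b * lam)"

lemma b_pos: "real b > 0"
  using b_ge by simp

lemma lam_pos: "lam > 0"
  using lam_gt b_pos less_trans[of 0 "1 / real b" lam] by simp

lemma gam_pos: "gam > 0"
  using b_pos lam_pos by (simp add: gam_def)

lemma gam_less_1: "gam < 1"
  using lam_gt b_pos lam_pos by (simp add: gam_def field_simps)

lemma lam_gam_b: "lam ^ n * gam ^ n * real b ^ n = 1"
  using b_pos lam_pos by (simp add: gam_def flip: power_mult_distrib)

abbreviation phi_der :: "nat \<Rightarrow> real \<Rightarrow> real" where "phi_der k \<equiv> (deriv ^^ k) phi"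

lemma phi_der_per: "phi_der k (x + 1) = phi_der k x"
proof (induction k arbitrary: x)
  case 0
  then show ?case by (simp add: phi_per)
next
  case (Suc k)
  then show ?case using deriv_periodic[of "phi_der k"] by simp
qed

lemma phi_der_DERIV:
  assumes "k < 5"
  shows "(phi_der k has_field_derivative phi_der (Suc k) x) (at x)"
  using phi_C5 assms by (simp add: Ck_def DERIV_deriv_iff_real_differentiable)

lemma phi_der_cont:
  assumes "k \<le> 5"
  shows "continuous_on UNIV (phi_der k)"
proof (cases "k = 5")
  case True
  then show ?thesis using phi_C5 by (simp add: Ck_def)
next
  case False
  then show ?thesis using phi_der_DERIV assms
    by (intro DERIV_continuous_on[of _ _ "phi_der (Suc k)"]) (auto intro: has_field_derivative_at_within)
qed

lemma phi_der_bound: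
  assumes "k \<le> 5"
  obtains B where "B \<ge> 0" "\<And>x. \<bar>phi_der k x\<bar> \<le> B"
  using periodic_continuous_bounded[OF phi_der_per phi_der_cont[OF assms]] by blast

lemma W_summable: "summable (\<lambda>n. lam ^ n * phi (real b ^ n * x))"
proof -
  obtain B where B: "\<And>x. \<bar>phi x\<bar> \<le> B" using phi_der_bound[of 0] by auto
  have "summable (\<lambda>n. lam ^ n * B)"
    using lam_pos lam_less_1 by (intro summable_mult2 summable_geometric) simp
  then show ?thesis
    by (rule summable_comparison_test'[where N = 0])
      (use B lam_pos in \<open>simp add: abs_mult mult_left_mono\<close>)
qed

lemma W_per: "W lam b phi (x + 1) = W lam b phi x"
proof -
  have "phi (real b ^ n * (x + 1)) = phi (real b ^ n * x)" for n
    using periodic_add_int[of phi "real b ^ n * x" "int b ^ n"] phi_per by (simp add: algebra_simps)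
  then show ?thesis by (simp add: W_def)
qed

lemmas W_add_int = periodic_add_int[of "W lam b phi", OF W_per]

lemma W_rec: "W lam b phi x = phi x + lam * W lam b phi (real b * x)"
proof -
  have "W lam b phi x = phi x + (\<Sum>n. lam ^ Suc n * phi (real b ^ Suc n * x))"
    using suminf_split_head[OF W_summable[of x]] by (simp add: W_def)
  also have "(\<lambda>n. lam ^ Suc n * phi (real b ^ Suc n * x)) =
      (\<lambda>n. lam * (lam ^ n * phi (real b ^ n * (real b * x))))"
    by (simp add: mult_ac)
  also have "(\<Sum>n. lam * (lam ^ n * phi (real b ^ n * (real b * x)))) = lam * W lam b phi (real b * x)"
    unfolding W_def by (rule suminf_mult[OF W_summable])
  finally show ?thesis .
qed

lemma W_cont: "continuous_on UNIV (W lam b phi)"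
proof -
  obtain B where B: "\<And>x. \<bar>phi x\<bar> \<le> B" using phi_der_bound[of 0] by auto
  have phic: "continuous_on UNIV phi" using phi_der_cont[of 0] by simp
  have "summable (\<lambda>n. lam ^ n * B)"
    using lam_pos lam_less_1 by (intro summable_mult2 summable_geometric) simp
  then have "uniform_limit UNIV (\<lambda>n x. \<Sum>i<n. lam ^ i * phi (real b ^ i * x))
      (\<lambda>x. \<Sum>i. lam ^ i * phi (real b ^ i * x)) sequentially"
    by (intro Weierstrass_m_test[where M = "\<lambda>n. lam ^ n * B"])
      (use B lam_pos in \<open>auto simp: abs_mult mult_left_mono\<close>)
  moreover have "continuous_on UNIV (\<lambda>x. \<Sum>i<n. lam ^ i * phi (real b ^ i * x))" for n
    by (intro continuous_intros continuous_on_compose2[OF phic]) auto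
  ultimately have "continuous_on UNIV (\<lambda>x. \<Sum>i. lam ^ i * phi (real b ^ i * x))"
    by (intro uniform_limit_theorem[where F = sequentially]) auto
  then show ?thesis by (simp add: W_def[abs_def])
qed

section \<open>The series \<open>G\<close> and the inverse branches\<close>

text \<open>\<open>- G\<close> extends \<open>Y\<close> from words to coherent sequences, where sums
  and integer multiples make sense.\<close>

definition G :: "(nat \<Rightarrow> int) \<Rightarrow> real \<Rightarrow> real" where
  "G u x = (\<Sum>m. gam ^ Suc m * deriv phi ((x + u (Suc m)) / real b ^ Suc m))"

definition G_part :: "nat \<Rightarrow> (nat \<Rightarrow> int) \<Rightarrow> real \<Rightarrow> real" where
  "G_part n u x = (\<Sum>m<n. gam ^ Suc m * deriv phi ((x + u (Suc m)) / real b ^ Suc m))"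

text \<open>An antiderivative of \<open>G_part\<close>: the inner derivative
  \<open>1 / b ^ Suc m\<close> turns powers of \<open>1 / lam\<close> into powers of
  \<open>gam\<close>. Powers of \<open>1 / lam\<close> grow, so only finite sums are formed.\<close>

definition S_part :: "nat \<Rightarrow> (nat \<Rightarrow> int) \<Rightarrow> real \<Rightarrow> real" where
  "S_part n u x = (\<Sum>m<n. (1 / lam) ^ Suc m * phi ((x + u (Suc m)) / real b ^ Suc m))"

lemma Y_eq_G: "Y lam b phi x j = - G (digits b j) x"
proof -
  have "(\<Sum>k=1..n. real (j (k - 1)) / real b ^ (n + 1 - k)) = digits b j n / real b ^ n" for n
  proof -
    have "(\<Sum>k=1..n. real (j (k - 1)) / real b ^ (n + 1 - k)) =
        (\<Sum>k<n. real (j k) / real b ^ (n - k))"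
      by (rule sum.reindex_bij_witness[of _ Suc "\<lambda>k. k - 1"]) auto
    also have "\<dots> = (\<Sum>k<n. real (j k) * real b ^ k / real b ^ n)"
      using b_pos by (intro sum.cong) (auto simp: power_diff)
    finally show ?thesis by (simp add: digits_def sum_divide_distrib)
  qed
  then show ?thesis
    by (simp only: Y_def G_def Let_def gam_def add_divide_distrib)
qed

text \<open>A geometric tail, since \<open>deriv phi\<close> is bounded. \<open>K\<close> depends
  neither on \<open>u\<close> nor on \<open>x\<close>, so later arguments may change the sequence
  with \<open>n\<close>.\<close>

lemma G_tail:
  obtains K where "K \<ge> 0" "\<And>n u x. \<bar>G u x - G_part n u x\<bar> \<le> K * gam ^ n"
proof -
  obtain B where B: "B \<ge> 0" "\<And>x. \<bar>deriv phi x\<bar> \<le> B" using phi_der_bound[of 1] by auto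
  have geo: "(\<lambda>m. gam ^ m) sums (1 / (1 - gam))"
    using gam_pos gam_less_1 by (intro geometric_sums) simp
  have "\<bar>G u x - G_part n u x\<bar> \<le> B / (1 - gam) * gam ^ n" for n u x
  proof -
    define h where "h = (\<lambda>m. gam ^ Suc m * deriv phi ((x + u (Suc m)) / real b ^ Suc m))"
    have h: "\<bar>h m\<bar> \<le> B * gam ^ m" for m
    proof -
      have "\<bar>h m\<bar> = gam ^ m * (gam * \<bar>deriv phi ((x + u (Suc m)) / real b ^ Suc m)\<bar>)"
        using gam_pos by (simp add: h_def abs_mult)
      also have "\<dots> \<le> gam ^ m * (1 * B)"
        using gam_pos gam_less_1 B by (intro mult_left_mono mult_mono) auto
      finally show ?thesis by (simp add: mult.commute)
    qed
    have "summable (\<lambda>m. B * gam ^ m)" using geo by (intro summable_mult) (simp add: sums_iff)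
    then have sumh: "summable h"
      by (rule summable_comparison_test'[where N = 0]) (use h in simp)
    have B_sums: "(\<lambda>m. B * gam ^ n * gam ^ m) sums (B * gam ^ n * (1 / (1 - gam)))"
      using geo by (rule sums_mult)
    have "G u x - G_part n u x = (\<Sum>m. h (m + n))"
      using suminf_minus_initial_segment[OF sumh, of n] by (simp add: G_def G_part_def h_def)
    also have "\<bar>\<dots>\<bar> \<le> (\<Sum>m. B * gam ^ n * gam ^ m)"
    proof -
      have "\<bar>h (m + n)\<bar> \<le> B * gam ^ n * gam ^ m" for m
        using h[of "m + n"] by (simp add: power_add mult_ac)
      then show ?thesis
        using norm_suminf_le[of "\<lambda>m. h (m + n)" "\<lambda>m. B * gam ^ n * gam ^ m"] B_sums
        by (simp add: sums_iff)
    qed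
    also have "\<dots> = B / (1 - gam) * gam ^ n" using B_sums by (simp add: sums_iff)
    finally show ?thesis .
  qed
  moreover have "B / (1 - gam) \<ge> 0" using B gam_less_1 by simp
  ultimately show thesis using that by blast
qed

lemma S_part_DERIV: "(S_part n u has_field_derivative G_part n u x) (at x)"
proof -
  have "((\<lambda>x. (1 / lam) ^ Suc m * phi ((x + u (Suc m)) / real b ^ Suc m)) has_field_derivative
      gam ^ Suc m * deriv phi ((x + u (Suc m)) / real b ^ Suc m)) (at x)" for m
  proof -
    have "((\<lambda>x. phi ((x + u (Suc m)) / real b ^ Suc m)) has_field_derivative
      deriv phi ((x + u (Suc m)) / real b ^ Suc m) * (1 / real b ^ Suc m)) (at x)"
      using phi_der_DERIV[of 0 "(x + u (Suc m)) / real b ^ Suc m"]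
      using b_pos by (intro DERIV_chain2[where f = phi]) (auto intro!: derivative_eq_intros)
    from DERIV_cmult[OF this, of "(1 / lam) ^ Suc m"] show ?thesis
      by (simp add: gam_def power_mult_distrib power_divide mult_ac)
  qed
  then show ?thesis unfolding S_part_def[abs_def] G_part_def by (intro DERIV_sum) auto
qed

text \<open>By coherence, the points \<open>(x + u n) / b ^ n\<close> form a backward orbit of
  \<open>x\<close> under multiplication by \<open>b\<close> modulo 1, along which
  \<open>W_rec\<close> is iterated.\<close>

lemma W_inverse_branch:
  assumes "coherent b u"
  shows "W lam b phi ((x + u n) / real b ^ n) = lam ^ n * (W lam b phi x + S_part n u x)"
proof (induction n)
  case 0
  \<comment> \<open>\<open>u 0\<close> is an arbitrary integer, hence the periodicity of
    \<open>W\<close>.\<close>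
  then show ?case using W_add_int[of x "u 0"] by (simp add: S_part_def)
next
  case (Suc n)
  obtain k where "u (Suc n) - u n = int b ^ n * k"
    using assms by (auto simp: coherent_def elim: dvdE)
  then have "u (Suc n) = u n + int b ^ n * k" by simp
  then have "(x + u (Suc n)) / real b ^ n = (x + u n) / real b ^ n + k"
    using b_pos by (simp add: field_simps)
  then have "W lam b phi (real b * ((x + u (Suc n)) / real b ^ Suc n)) = W lam b phi ((x + u n) / real b ^ n)"
    using W_add_int b_pos by simp
  then have "W lam b phi ((x + u (Suc n)) / real b ^ Suc n) =
      phi ((x + u (Suc n)) / real b ^ Suc n) + lam * (lam ^ n * (W lam b phi x + S_part n u x))"
    using W_rec[of "(x + u (Suc n)) / real b ^ Suc n"] Suc by simp
  also have "\<dots> = lam ^ Suc n * (W lam b phi x + S_part (Suc n) u x)"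
    using lam_pos by (simp add: S_part_def field_simps)
  finally show ?case .
qed

text \<open>The possibly rough term \<open>W x\<close> cancels, so the difference between two
  branches is as smooth as \<open>phi\<close>.\<close>

lemma W_branch_difference:
  assumes "coherent b u" "coherent b v"
  shows "W lam b phi ((x + u n) / real b ^ n) - W lam b phi ((x + v n) / real b ^ n) =
    lam ^ n * (S_part n u x - S_part n v x)"
  unfolding W_inverse_branch[OF assms(1)] W_inverse_branch[OF assms(2)]
  by (simp add: algebra_simps)

text \<open>The increment of \<open>W\<close> over \<open>s\<close> is \<open>lam ^ n\<close> times
  a rescaled \<open>D\<close>. Since \<open>G u = G v\<close>, the derivative of \<open>D\<close> is
  at most two tails of size \<open>K * gam ^ n\<close>; rescaling adds \<open>b ^ n\<close>, and the
  three powers multiply to 1.\<close>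

lemma W_translate_lipschitz:
  assumes K: "\<And>n u x. \<bar>G u x - G_part n u x\<bar> \<le> K * gam ^ n"
    and "coherent b u" "coherent b v" and eq: "\<And>x. G u x = G v x"
    and s: "s = real_of_int (u n - v n) / real b ^ n"
  shows "\<bar>(W lam b phi (y + s) - W lam b phi y) - (W lam b phi (z + s) - W lam b phi z)\<bar>
    \<le> 2 * K * \<bar>y - z\<bar>"
proof -
  define D where "D x = S_part n u x - S_part n v x" for x
  have "(D has_field_derivative G_part n u x - G_part n v x) (at x)" for x
    unfolding D_def[abs_def] by (intro DERIV_diff S_part_DERIV)
  moreover have "\<bar>G_part n u x - G_part n v x\<bar> \<le> 2 * K * gam ^ n" for x
    using K[of u x n] K[of v x n] eq[of x] by linarith
  ultimately have lipD: "\<bar>D x - D x'\<bar> \<le> 2 * K * gam ^ n * \<bar>x - x'\<bar>" for x x'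
    using field_differentiable_bound[of UNIV D "\<lambda>x. G_part n u x - G_part n v x" "2 * K * gam ^ n" x x']
    by auto
  \<comment> \<open>The base point is chosen so that the branch of \<open>v\<close> ends at
    \<open>y\<close> and the branch of \<open>u\<close> at \<open>y + s\<close>.\<close>
  have W_D: "W lam b phi (y + s) - W lam b phi y = lam ^ n * D (real b ^ n * y - v n)" for y
    using W_branch_difference[OF assms(2,3), of "real b ^ n * y - v n" n] b_pos
    by (simp add: D_def s field_simps)
  have "\<bar>lam ^ n * D (real b ^ n * y - v n) - lam ^ n * D (real b ^ n * z - v n)\<bar>
      = lam ^ n * \<bar>D (real b ^ n * y - v n) - D (real b ^ n * z - v n)\<bar>"
    using lam_pos by (simp add: abs_mult flip: right_diff_distrib)
  also have "\<dots> \<le> lam ^ n * (2 * K * gam ^ n * \<bar>(real b ^ n * y - v n) - (real b ^ n * z - v n)\<bar>)"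
    using lam_pos by (intro mult_left_mono lipD) simp
  also have "\<bar>(real b ^ n * y - v n) - (real b ^ n * z - v n)\<bar> = real b ^ n * \<bar>y - z\<bar>"
    using b_pos by (simp add: abs_mult flip: right_diff_distrib)
  also have "lam ^ n * (2 * K * gam ^ n * (real b ^ n * \<bar>y - z\<bar>)) =
      (lam ^ n * gam ^ n * real b ^ n) * (2 * K * \<bar>y - z\<bar>)"
    by (simp only: mult_ac)
  finally show ?thesis unfolding W_D lam_gam_b by simp
qed

text \<open>Along each branch, \<open>W\<close> has slope at most \<open>C / b ^ n\<close>. Dividing
  by \<open>lam ^ n\<close> bounds the derivative of \<open>D\<close> by
  \<open>2 * C * gam ^ n\<close>; two tails add \<open>2 * K * gam ^ n\<close>, and \<open>n\<close>
  is arbitrary.\<close>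

lemma G_eq_if_lipschitz:
  assumes lip: "C-lipschitz_on UNIV (W lam b phi)" and "coherent b u" "coherent b v"
  shows "G u x = G v x"
proof -
  obtain K where "K \<ge> 0" and K: "\<And>n u x. \<bar>G u x - G_part n u x\<bar> \<le> K * gam ^ n" using G_tail by blast
  have "\<bar>G u x - G v x\<bar> \<le> (2 * C + 2 * K) * gam ^ n" for n
  proof -
    define D where "D x = S_part n u x - S_part n v x" for x
    have D: "(D has_field_derivative G_part n u x - G_part n v x) (at x)"
      unfolding D_def[abs_def] by (intro DERIV_diff S_part_DERIV)
    have "\<bar>D y - D x\<bar> \<le> 2 * C * gam ^ n * \<bar>y - x\<bar>" for y
    proof -
      have W_lip: "\<bar>W lam b phi ((y + k) / real b ^ n) - W lam b phi ((x + k) / real b ^ n)\<bar>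
          \<le> C * \<bar>y - x\<bar> / real b ^ n" for k :: real
        using lipschitz_onD[OF lip, of "(y + k) / real b ^ n" "(x + k) / real b ^ n"] b_pos
        by (simp add: dist_real_def abs_divide flip: diff_divide_distrib)
      have "lam ^ n * \<bar>D y - D x\<bar> = \<bar>lam ^ n * D y - lam ^ n * D x\<bar>"
        using lam_pos by (simp add: abs_mult flip: right_diff_distrib)
      also have "\<dots> \<le> 2 * (C * \<bar>y - x\<bar> / real b ^ n)"
        using W_lip[of "u n"] W_lip[of "v n"] unfolding D_def W_branch_difference[OF assms(2,3), symmetric]
        by linarith
      also have "\<dots> = (lam ^ n * gam ^ n * real b ^ n) * (2 * (C * \<bar>y - x\<bar> / real b ^ n))"
        by (simp add: lam_gam_b)
      also have "\<dots> = lam ^ n * (2 * C * gam ^ n * \<bar>y - x\<bar>)" using b_pos by simp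
      finally show ?thesis using lam_pos by simp
    qed
    then have "\<bar>G_part n u x - G_part n v x\<bar> \<le> 2 * C * gam ^ n"
      by (rule DERIV_abs_le_of_lipschitz[OF D])
    then show ?thesis using K[of u x n] K[of v x n] unfolding distrib_right by linarith
  qed
  then have "G u x - G v x = 0"
    by (rule eq_0_if_geometric_bound[OF less_imp_le[OF gam_pos] gam_less_1])
  then show ?thesis by simp
qed

section \<open>Periods of \<open>G\<close> and the Lipschitz property\<close>

text \<open>Since \<open>deriv phi\<close> has period 1, the term with \<open>b ^ Suc m\<close> sees
  only \<open>u (Suc m)\<close> modulo \<open>b ^ Suc m\<close>, which coherence recovers from level
  \<open>n\<close>.\<close>

lemma G_part_cong:
  assumes "coherent b u" "coherent b v" "int b ^ n dvd u n - v n"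
  shows "G_part n u x = G_part n v x"
  unfolding G_part_def
proof (intro sum.cong refl)
  fix m assume "m \<in> {..<n}"
  then have m: "Suc m \<le> n" by simp
  have "int b ^ Suc m dvd (u n - v n) - (u n - u (Suc m)) + (v n - v (Suc m))"
    by (intro dvd_add dvd_diff[of _ "u n - v n"] coherent_dvd[OF assms(1) m] coherent_dvd[OF assms(2) m]
        dvd_trans[OF le_imp_power_dvd[OF m] assms(3)])
  then have "int b ^ Suc m dvd u (Suc m) - v (Suc m)" by simp
  then obtain k where "u (Suc m) - v (Suc m) = int b ^ Suc m * k" by (elim dvdE)
  then have "u (Suc m) = v (Suc m) + int b ^ Suc m * k" by simp
  then have "(x + u (Suc m)) / real b ^ Suc m = (x + v (Suc m)) / real b ^ Suc m + k"
    using b_pos by (simp add: field_simps)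
  then show "gam ^ Suc m * deriv phi ((x + u (Suc m)) / real b ^ Suc m) =
      gam ^ Suc m * deriv phi ((x + v (Suc m)) / real b ^ Suc m)"
    using periodic_add_int[of "deriv phi"] phi_der_per[of 1] by simp
qed

text \<open>If \<open>G u = G v\<close> then \<open>v - u\<close> is a period of \<open>z \<mapsto> G z\<close>: this holds at the integer translates
  of \<open>u\<close>, since \<open>G (u + t) x = G u (x + t)\<close>, and these are dense among the coherent sequences.\<close>

lemma G_period:
  assumes u: "coherent b u" and v: "coherent b v" and z: "coherent b z" and eq: "\<And>x. G u x = G v x"
  shows "G (\<lambda>n. z n + (v n - u n)) x = G z x"
proof -
  obtain K where "K \<ge> 0" and K: "\<And>n u x. \<bar>G u x - G_part n u x\<bar> \<le> K * gam ^ n" using G_tail by blast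
  have "\<bar>G (\<lambda>n. z n + (v n - u n)) x - G z x\<bar> \<le> 4 * K * gam ^ n" for n
  proof -
    \<comment> \<open>With this integer, \<open>u + t\<close> agrees with \<open>z\<close>, and
      \<open>v + t\<close> with \<open>z + (v - u)\<close>, modulo \<open>b ^ n\<close>. Four tails
      give the constant \<open>4 * K\<close>.\<close>
    define t where "t = z n - u n"
    have shift: "G (\<lambda>n. w n + t) x = G w (x + t)" for w
      by (simp add: G_def add_ac)
    have "G_part n (\<lambda>n. z n + (v n - u n)) x = G_part n (\<lambda>n. v n + t) x"
      by (intro G_part_cong coherent_add coherent_diff coherent_const u v z) (simp add: t_def)
    moreover have "G_part n z x = G_part n (\<lambda>n. u n + t) x"
      by (intro G_part_cong coherent_add coherent_const u z) (simp add: t_def)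
    moreover have "G (\<lambda>n. v n + t) x = G (\<lambda>n. u n + t) x"
      unfolding shift eq ..
    ultimately show ?thesis
      using K[of "\<lambda>n. z n + (v n - u n)" x n] K[of z x n] K[of "\<lambda>n. v n + t" x n] K[of "\<lambda>n. u n + t" x n]
      by linarith
  qed
  then have "G (\<lambda>n. z n + (v n - u n)) x - G z x = 0"
    by (rule eq_0_if_geometric_bound[OF less_imp_le[OF gam_pos] gam_less_1])
  then show ?thesis by simp
qed

text \<open>Starting from the zero sequence, each use of \<open>G_period\<close> adds or removes one
  copy of \<open>v - u\<close>.\<close>

lemma G_multiple_period:
  assumes "coherent b u" "coherent b v" "\<And>x. G u x = G v x"
  shows "G (\<lambda>n. k * (v n - u n)) x = G (\<lambda>n. 0) x"
proof -
  have coh: "coherent b (\<lambda>n. k * (v n - u n))" for k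
    by (intro coherent_mult coherent_diff assms)
  have step: "G (\<lambda>n. (k + 1) * (v n - u n)) x = G (\<lambda>n. k * (v n - u n)) x" for k
    using G_period[OF assms(1,2) coh[of k] assms(3), of x] by (simp add: algebra_simps)
  show ?thesis
  proof (induction k rule: int_induct[where k = 0])
    case (step2 i)
    then show ?case using step[of "i - 1"] by simp
  qed (use step in simp_all)
qed

lemma lipschitz_if_G_eq:
  assumes u: "coherent b u" and v: "coherent b v" and eq: "\<And>x. G u x = G v x"
    and neq: "\<not> int b ^ N dvd v N - u N"
  shows "\<exists>C. C-lipschitz_on UNIV (W lam b phi)"
proof -
  obtain K where K: "K \<ge> 0" "\<And>n u x. \<bar>G u x - G_part n u x\<bar> \<le> K * gam ^ n" using G_tail by blast
  define d where "d = (\<lambda>n. v n - u n)"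
  have d: "coherent b d" unfolding d_def by (intro coherent_diff u v)
  let ?w = "W lam b phi"
  let ?D = "\<lambda>x y t. \<bar>(?w (x + t) - ?w x) - (?w (y + t) - ?w y)\<bar>"
  \<comment> \<open>The sequence \<open>k * d\<close> is compared with the zero sequence; the
    integer \<open>l\<close> is absorbed by the period of \<open>W\<close>.\<close>
  have grid: "?D x y (real_of_int (k * d n) / real b ^ n + real_of_int l) \<le> 2 * K * \<bar>x - y\<bar>" for x y n k l
    using W_translate_lipschitz[OF K(2), of "\<lambda>n. k * d n" "\<lambda>n. 0" "real_of_int (k * d n) / real b ^ n" n x y]
      coherent_mult[OF d] coherent_const[of b 0] G_multiple_period[OF u v eq]
      W_add_int
    by (simp add: d_def flip: add.assoc)
  have all: "?D x y t \<le> 2 * K * \<bar>x - y\<bar>" for x y t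
  proof (rule ccontr)
    assume neg: "\<not> ?D x y t \<le> 2 * K * \<bar>x - y\<bar>"
    have wc: "isCont ?w z" for z
      using W_cont by (simp add: continuous_on_eq_continuous_at)
    have "isCont (\<lambda>t. ?D x y t) t"
      by (intro continuous_intros isCont_o2[OF _ wc])
    then have "((\<lambda>s. ?D x y s) \<longlongrightarrow> ?D x y t) (at t)"
      by (simp add: isCont_def)
    then have "eventually (\<lambda>s. ?D x y s > 2 * K * \<bar>x - y\<bar>) (at t)"
      by (rule order_tendstoD) (use neg in simp)
    then obtain e where e: "e > 0" "\<And>s. s \<noteq> t \<Longrightarrow> dist s t < e \<Longrightarrow> ?D x y s > 2 * K * \<bar>x - y\<bar>"
      unfolding eventually_at by auto
    obtain n k l where "\<bar>real_of_int (k * d n) / real b ^ n + real_of_int l - t\<bar> < e"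
      using coherent_multiples_dense[OF b_ge d, of N e t] neq e(1) by (auto simp: d_def)
    \<comment> \<open>A violation at \<open>t\<close> persists nearby by continuity, hence at a grid
      shift. The punctured neighbourhood omits \<open>t\<close> itself, so a grid shift equal to
      \<open>t\<close> is a separate case.\<close>
    then show False
      using e(2)[of "real_of_int (k * d n) / real b ^ n + real_of_int l"] grid[of x k n l y] neg
      by (cases "real_of_int (k * d n) / real b ^ n + real_of_int l = t") (auto simp: dist_real_def)
  qed
  obtain M where "\<And>x. \<bar>?w x\<bar> \<le> M"
    using periodic_continuous_bounded[OF W_per W_cont] by blast
  then have "\<bar>?w x - ?w y\<bar> \<le> 2 * K * \<bar>x - y\<bar>" for x y
    using all by (rule lipschitz_if_differences_lipschitz)
  then have "(2 * K)-lipschitz_on UNIV ?w"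
    using K(1) by (intro lipschitz_onI) (auto simp: dist_real_def)
  then show ?thesis by blast
qed

text \<open>Iterating the functional equation along \<open>x, x / b, x / b\<^sup>2, \<dots>\<close> leaves the remainder
  \<open>\<lambda>\<^sup>-\<^sup>n (W (x / b\<^sup>n) - W 0)\<close>, which vanishes in the limit when \<open>W\<close> is Lipschitz.\<close>

lemma W_sums_if_lipschitz:
  assumes lip: "C-lipschitz_on UNIV (W lam b phi)"
  shows "(\<lambda>m. - ((1 / lam) ^ Suc m * (phi (x / real b ^ Suc m) - phi 0))) sums (W lam b phi x - W lam b phi 0)"
proof -
  let ?w = "W lam b phi"
  let ?s = "\<lambda>n. \<Sum>m<n. - ((1 / lam) ^ Suc m * (phi (x / real b ^ Suc m) - phi 0))"
  have w: "?w x - ?w 0 - ?s n = (?w (x / real b ^ n) - ?w 0) / lam ^ n" for n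
  proof -
    have s: "?s n = - (S_part n (\<lambda>_. 0) x - S_part n (\<lambda>_. 0) 0)"
      unfolding S_part_def by (simp add: sum_negf right_diff_distrib sum_subtractf)
    \<comment> \<open>The zero branch is taken at \<open>x\<close> and at the fixed point 0, and the
      two identities are subtracted.\<close>
    have "?w (x / real b ^ n) - ?w 0 =
        lam ^ n * (?w x - ?w 0 + (S_part n (\<lambda>_. 0) x - S_part n (\<lambda>_. 0) 0))"
      using W_inverse_branch[OF coherent_const, of x 0 n] W_inverse_branch[OF coherent_const, of 0 0 n]
      by (simp add: algebra_simps)
    then show ?thesis unfolding s using lam_pos by simp
  qed
  have bound: "\<bar>?w x - ?w 0 - ?s n\<bar> \<le> C * \<bar>x\<bar> * gam ^ n" for n
  proof -
    have "\<bar>?w (x / real b ^ n) - ?w 0\<bar> \<le> C * (\<bar>x\<bar> / real b ^ n)"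
      using lipschitz_onD[OF lip, of "x / real b ^ n" 0] b_pos by (simp add: dist_real_def abs_divide)
    then have "\<bar>?w x - ?w 0 - ?s n\<bar> \<le> C * (\<bar>x\<bar> / real b ^ n) / lam ^ n"
      unfolding w abs_divide using lam_pos by (simp add: divide_right_mono del: divide_divide_eq_left)
    also have "\<dots> = C * \<bar>x\<bar> * gam ^ n" by (simp add: gam_def power_divide power_mult_distrib)
    finally show ?thesis .
  qed
  have "(\<lambda>n. C * \<bar>x\<bar> * gam ^ n) \<longlonglongrightarrow> 0"
    using gam_pos gam_less_1 by (intro tendsto_mult_right_zero LIMSEQ_power_zero) simp
  then have "(\<lambda>n. ?w x - ?w 0 - ?s n) \<longlonglongrightarrow> 0"
    by (rule Lim_null_comparison[rotated]) (simp only: real_norm_def bound eventually_True)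
  then have "(\<lambda>n. (?w x - ?w 0) - (?w x - ?w 0 - ?s n)) \<longlonglongrightarrow> (?w x - ?w 0) - 0"
    by (intro tendsto_intros)
  then show ?thesis by (simp add: sums_def)
qed

section \<open>Termwise differentiation of the series for \<open>W\<close>\<close>

text \<open>The formal derivative of order \<open>k\<close> of the series for
  \<open>W x - W 0\<close>, meant for \<open>1 \<le> k\<close>: at \<open>k = 0\<close> the ratio
  \<open>1 / lam\<close> exceeds 1 and \<open>phi 0\<close> has to be subtracted in each
  term.\<close>

definition W_der :: "nat \<Rightarrow> real \<Rightarrow> real" where
  "W_der k x = (\<Sum>m. - ((1 / (lam * real b ^ k)) ^ Suc m * phi_der k (x / real b ^ Suc m)))"

text \<open>For \<open>1 \<le> k\<close> the ratio is at most \<open>gam\<close>, so a single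
  geometric series dominates.\<close>

lemma W_der_uniform:
  assumes "1 \<le> k" "k \<le> 5"
  shows "uniform_limit UNIV (\<lambda>n x. \<Sum>m<n. - ((1 / (lam * real b ^ k)) ^ Suc m * phi_der k (x / real b ^ Suc m)))
    (W_der k) sequentially"
proof -
  obtain B where B: "B \<ge> 0" "\<And>x. \<bar>phi_der k x\<bar> \<le> B" using phi_der_bound[OF assms(2)] by blast
  have "real b ^ 1 \<le> real b ^ k" using b_ge assms by (intro power_increasing) auto
  then have le: "1 / (lam * real b ^ k) \<le> gam"
    using lam_pos b_pos unfolding gam_def by (intro divide_left_mono) auto
  have nn: "0 \<le> 1 / (lam * real b ^ k)" using lam_pos b_pos by simp
  have "summable (\<lambda>m. gam ^ m * (gam * B))"
    using gam_pos gam_less_1 by (intro summable_mult2 summable_geometric) simp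
  then show ?thesis
    unfolding W_der_def[abs_def]
  proof (rule Weierstrass_m_test[rotated])
    fix m x
    have "norm (- ((1 / (lam * real b ^ k)) ^ Suc m * phi_der k (x / real b ^ Suc m))) =
        (1 / (lam * real b ^ k)) ^ Suc m * \<bar>phi_der k (x / real b ^ Suc m)\<bar>"
      using abs_of_nonneg[OF zero_le_power[OF nn, of "Suc m"]]
      by (simp only: real_norm_def abs_minus_cancel abs_mult)
    also have "\<dots> \<le> gam ^ Suc m * B"
      using B gam_pos by (intro mult_mono power_mono le nn) auto
    finally show "norm (- ((1 / (lam * real b ^ k)) ^ Suc m * phi_der k (x / real b ^ Suc m)))
        \<le> gam ^ m * (gam * B)" by (simp add: mult_ac)
  qed
qed

text \<open>The constant \<open>c\<close> treats both cases at once: \<open>phi 0\<close> for the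
  first derivative, 0 for the later ones.\<close>

lemma W_der_term_DERIV:
  assumes "k < 5"
  shows "((\<lambda>x. - ((1 / (lam * real b ^ k)) ^ Suc m * (phi_der k (x / real b ^ Suc m) - c)))
    has_field_derivative - ((1 / (lam * real b ^ Suc k)) ^ Suc m * phi_der (Suc k) (x / real b ^ Suc m)))
    (at x)"
proof -
  have "((\<lambda>x. phi_der k (x / real b ^ Suc m)) has_field_derivative
      phi_der (Suc k) (x / real b ^ Suc m) * (1 / real b ^ Suc m)) (at x)"
    using b_pos by (intro DERIV_chain2[OF phi_der_DERIV[OF assms]]) (auto intro!: derivative_eq_intros)
  then have "((\<lambda>x. - ((1 / (lam * real b ^ k)) ^ Suc m * (phi_der k (x / real b ^ Suc m) - c)))
      has_field_derivative
      - ((1 / (lam * real b ^ k)) ^ Suc m * (phi_der (Suc k) (x / real b ^ Suc m) * (1 / real b ^ Suc m) - 0)))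
    (at x)"
    by (intro DERIV_minus DERIV_cmult DERIV_diff DERIV_const)
  also have "(1 / (lam * real b ^ k)) ^ Suc m * (phi_der (Suc k) (x / real b ^ Suc m) * (1 / real b ^ Suc m) - 0)
      = (1 / (lam * real b ^ k)) ^ Suc m * (1 / real b) ^ Suc m * phi_der (Suc k) (x / real b ^ Suc m)"
    by (simp add: power_divide)
  also have "(1 / (lam * real b ^ k)) ^ Suc m * (1 / real b) ^ Suc m = (1 / (lam * real b ^ Suc k)) ^ Suc m"
    by (simp only: power_mult_distrib[symmetric]) (simp add: mult_ac)
  finally show ?thesis .
qed

lemma series_DERIV:
  assumes "k < 5"
    and lim: "\<And>x. (\<lambda>m. - ((1 / (lam * real b ^ k)) ^ Suc m * (phi_der k (x / real b ^ Suc m) - c))) sums g x"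
  shows "(g has_field_derivative W_der (Suc k) x) (at x)"
proof -
  let ?f = "\<lambda>m x. - ((1 / (lam * real b ^ k)) ^ Suc m * (phi_der k (x / real b ^ Suc m) - c))"
  have "\<exists>h. \<forall>x\<in>UNIV. (\<lambda>m. ?f m x) sums h x \<and> (h has_field_derivative W_der (Suc k) x) (at x within UNIV)"
    by (rule has_field_derivative_series[OF convex_UNIV W_der_term_DERIV[OF assms(1)] W_der_uniform
        UNIV_I sums_summable[OF lim]]) (use assms(1) in auto)
  then obtain h where h: "\<And>x. (\<lambda>m. ?f m x) sums h x" "\<And>x. (h has_field_derivative W_der (Suc k) x) (at x)"
    by blast
  \<comment> \<open>Termwise differentiation supplies only some limit \<open>h\<close>; uniqueness
    of sums identifies it with \<open>g\<close>.\<close>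
  have "h = g" using sums_unique2[OF h(1) lim] by (simp add: fun_eq_iff)
  then show ?thesis using h(2) by simp
qed

lemma W_C5_if_lipschitz:
  assumes lip: "C-lipschitz_on UNIV (W lam b phi)"
  shows "Ck 5 (W lam b phi)"
proof -
  have W1: "(W lam b phi has_field_derivative W_der 1 x) (at x)" for x
  proof -
    have "((\<lambda>x. W lam b phi x - W lam b phi 0) has_field_derivative W_der (Suc 0) x) (at x)"
      by (rule series_DERIV[where c = "phi 0"]) (use W_sums_if_lipschitz[OF lip] in simp_all)
    from DERIV_add[OF this DERIV_const[of "W lam b phi 0"]] show ?thesis by simp
  qed
  have W_der_DERIV: "(W_der k has_field_derivative W_der (Suc k) x) (at x)" if "1 \<le> k" "k < 5" for k x
  proof (rule series_DERIV[OF that(2), where c = 0])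
    fix x
    have "(\<lambda>n. \<Sum>m<n. - ((1 / (lam * real b ^ k)) ^ Suc m * phi_der k (x / real b ^ Suc m))) \<longlonglongrightarrow> W_der k x"
      using tendsto_uniform_limitI[OF W_der_uniform[of k]] that by simp
    then show "(\<lambda>m. - ((1 / (lam * real b ^ k)) ^ Suc m * (phi_der k (x / real b ^ Suc m) - 0))) sums W_der k x"
      by (simp add: sums_def)
  qed
  \<comment> \<open>The orders start at \<open>Suc k\<close>, because \<open>W_der 0\<close> does
    not stand for \<open>W\<close>.\<close>
  have der: "(deriv ^^ Suc k) (W lam b phi) = W_der (Suc k)" if "k < 5" for k
    using that
  proof (induction k)
    case 0
    then show ?case using DERIV_imp_deriv[OF W1] by (simp add: fun_eq_iff)
  next
    case (Suc k)
    then have "(deriv ^^ Suc (Suc k)) (W lam b phi) = deriv (W_der (Suc k))" by simp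
    also have "\<dots> = W_der (Suc (Suc k))"
      using Suc.prems by (intro ext DERIV_imp_deriv W_der_DERIV) auto
    finally show ?case .
  qed
  have "(deriv ^^ j) (W lam b phi) differentiable (at x)" if "j < 5" for j x
  proof (cases j)
    case 0
    then show ?thesis using W1 by (auto simp: real_differentiable_def)
  next
    case (Suc k)
    then show ?thesis using that der[of k] W_der_DERIV[of j x] by (auto simp: real_differentiable_def)
  qed
  moreover have "continuous_on UNIV (W_der 5)"
  proof (rule uniform_limit_theorem[OF _ W_der_uniform])
    have c5: "continuous_on UNIV (phi_der 5)" using phi_der_cont by simp
    show "\<forall>\<^sub>F n in sequentially. continuous_on UNIV
        (\<lambda>x. \<Sum>m<n. - ((1 / (lam * real b ^ 5)) ^ Suc m * phi_der 5 (x / real b ^ Suc m)))"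
      using b_pos by (intro always_eventually allI continuous_intros continuous_on_compose2[OF c5]) auto
  qed auto
  ultimately show ?thesis using der[of 4] by (simp add: Ck_def)
qed

section \<open>Consequences for \<open>cond_H\<close> and \<open>cond_H_star\<close>\<close>

lemma cond_H_star_if_lipschitz:
  assumes "C-lipschitz_on UNIV (W lam b phi)"
  shows "cond_H_star lam b phi"
  using G_eq_if_lipschitz[OF assms coherent_digits coherent_digits]
  by (simp add: cond_H_star_def Y_eq_G)

lemma lipschitz_if_not_cond_H:
  assumes "\<not> cond_H lam b phi"
  shows "\<exists>C. C-lipschitz_on UNIV (W lam b phi)"
proof -
  obtain i j where ij: "i \<in> Sigma_b b" "j \<in> Sigma_b b" "i \<noteq> j"
    and eq: "\<And>x. G (digits b i) x = G (digits b j) x"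
    using assms unfolding cond_H_def Y_eq_G by auto
  obtain N where "\<not> int b ^ N dvd digits b j N - digits b i N"
    using digits_neq[OF b_ge ij(2,1)] ij(3) by blast
  then show ?thesis
    by (rule lipschitz_if_G_eq[OF coherent_digits coherent_digits eq])
qed

text \<open>As \<open>b \<ge> 2\<close>, there are two distinct words, and on them the conditions
  contradict each other.\<close>

lemma not_cond_H_and_H_star: "\<not> (cond_H lam b phi \<and> cond_H_star lam b phi)"
proof -
  have "(\<lambda>_. 0) \<in> Sigma_b b" "(\<lambda>_. 1) \<in> Sigma_b b" "(\<lambda>_. 0) \<noteq> (\<lambda>_::nat. 1::nat)"
    using b_ge by (auto simp: Sigma_b_def fun_eq_iff)
  then show ?thesis unfolding cond_H_def cond_H_star_def by blast
qed

end

theorem theoremA: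
  fixes b :: nat and lam :: real and phi :: "real \<Rightarrow> real"
  assumes "b \<ge> 2" and "1 / real b < lam" and "lam < 1"
    and "periodic1 phi" and "Ck 5 phi"
  shows "let P1 = (Ck 5 (W lam b phi) \<and> cond_H_star lam b phi);
             P2 = ((\<not> (\<exists>C. C-lipschitz_on UNIV (W lam b phi))) \<and> cond_H lam b phi)
         in (P1 \<or> P2) \<and> \<not> (P1 \<and> P2)"
proof -
  interpret weierstrass b lam phi
    using assms by unfold_locales (auto simp: periodic1_def)
  show ?thesis
    unfolding Let_def
    \<comment> \<open>Split on whether \<open>W\<close> is Lipschitz: if so, the first alternative
      holds, otherwise the second. They exclude each other through \<open>cond_H\<close> and
      \<open>cond_H_star\<close>.\<close>
    using W_C5_if_lipschitz cond_H_star_if_lipschitz lipschitz_if_not_cond_H not_cond_H_and_H_star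
    by blast
qed

end
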